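(* Let $f = f_{0}+\sum_{j=1}^n f_{\alpha(j)} x^{\alpha(j)} +\sum_{\alpha \in \Delta(f)} f_\alpha x^\alpha\in\mathbb{R}[x_1,\dots,x_n]$ be an ST-polynomial of degree $2d$ in standard form. Let $R$ be the subset of an $n|\Delta(f)|$-dimensional real space given by $$R=\{(a_{\alpha,i}) : a_{\alpha,i}\in\mathbb{R}_{>0}\text{ for every }(\alpha,i)\in\Delta(f)\times\{1,\ldots,n\}\}.$$ Then $f_{\mathrm{gp}}=f_0-m^*$, where $m^*$ is given as the output (optimal value) of the following geometric program: minimize $$\sum_{\alpha\in \Delta(f),\ \lambda_0^{(\alpha)} \neq 0}\lambda_0^{(\alpha)} |f_\alpha|^{1/\lambda_0^{(\alpha)}} \prod_{j\in \mathrm{nz}(\alpha),\, j\geq 1}\left(\frac{\lambda_j^{(\alpha)}}{a_{\alpha,j}}\right)^{\lambda_j^{(\alpha)}/\lambda_0^{(\alpha)}}$$ over the subset $R'$ of $R$ defined by (1) $\sum_{\alpha\in \Delta(f)} \left(a_{\alpha,j}/f_{\alpha(j)}\right) \leq 1$ for every $1 \leq j \leq n$; (2) $|f_\alpha| \prod_{j\in \mathrm{nz}(\alpha),\, j\geq 1}\left(\frac{\lambda_j^{(\alpha)}}{a_{\alpha,j}}\right)^{ \lambda_j^{(\alpha)}} \leq 1$ for every $\alpha\in \Delta(f)$ with $\lambda_0^{(\alpha)}=0$.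
   Context: Notation: $\mathbb{N}$ contains $0$; $x^\alpha = x_1^{\alpha_1}\cdots x_n^{\alpha_n}$; $\mathrm{New}(f)$ is the Newton polytope of $f$, i.e. the convex hull of the exponents with nonzero coefficient. An ST-polynomial in standard form is a polynomial $f = f_{\alpha(0)}+\sum_{j=1}^n f_{\alpha(j)} x^{\alpha(j)} +\sum_{\alpha \in \Delta} f_\alpha x^\alpha$ such that: (ST1) $\alpha(0)=0$ and $\alpha(1),\ldots,\alpha(n)$ form a set $V$ of affinely independent points in $(2\mathbb{N})^n$. (ST2) $\Delta$ is the set of exponents $\alpha$ in $f$ not defining monomial squares, i.e. $\alpha\in\Delta$ iff $f_\alpha<0$, or $\alpha\notin(2\mathbb{N})^n$ and $f_\alpha>0$. (ST3) $\Delta\subseteq \mathrm{conv}(V)$; equivalently every $\alpha\in\Delta$ is uniquely written $\alpha=\sum_{j=0}^n\lambda_j^{(\alpha)}\alpha(j)$ with $\lambda_j^{(\alpha)}\ge 0$, $\sum_{j=0}^n\lambda_j^{(\alpha)}=1$. (ST4) $f_0 = f_{\alpha(0)},f_{\alpha(1)},\ldots,f_{\alpha(n)}$ are nonnegative, and if $f_{\alpha(j)}=0$ then $\lambda_j^{(\alpha)}=0$ for all $\alpha\in\Delta$. One writes $\Delta(f)=\Delta$ and $\mathrm{nz}(\alpha)=\{j\in\{0,\ldots,n\}:\lambda_j^{(\alpha)}\neq 0\}$. $f_{\mathrm{gp}}$ is the supremum of all $r\in\mathbb{R}$ for which there exist reals $a_{\alpha,j}\ge 0$, $(\alpha,j)\in\Delta(f)\times\{1,\dots,n\}$,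 such that: (i) $a_{\alpha,j}>0$ whenever $\lambda_j^{(\alpha)}>0$; (ii) $|f_\alpha| \leq \prod_{j\in \mathrm{nz}(\alpha), j\geq 1} (a_{\alpha,j}/\lambda_j^{(\alpha)})^{\lambda_j^{(\alpha)}}$ for every $\alpha\in\Delta(f)$ with $\lambda_0^{(\alpha)}=0$; (iii) $f_{\alpha(j)}\ge\sum_{\alpha\in\Delta(f)}a_{\alpha,j}$ for $j=1,\dots,n$; (iv) $f_0-r \geq \sum_{\alpha \in \Delta(f), 0 \in \mathrm{nz}(\alpha)} \lambda_0^{(\alpha)} |f_\alpha|^{1/\lambda_0^{(\alpha)}} \prod_{j\in \mathrm{nz}(\alpha), j\geq 1} (\lambda_j^{(\alpha)}/a_{\alpha,j})^{\lambda_j^{(\alpha)}/\lambda_0^{(\alpha)}}$. This number is also equal to the supremum of all $r\in\mathbb{R}$ such that $f-r$ is a finite sum of nonnegative circuit polynomials (ST-polynomials with $\Delta$ empty or a singleton that are $\ge 0$ on $\mathbb{R}^n$) whose Newton polytopes are faces of the convex hull of $0$ and the vertices of $\mathrm{New}(f)$. A monomial function on $\mathbb{R}_{>0}^N$ is $z\mapsto c z_1^{\beta_1}\cdots z_N^{\beta_N}$ with $c>0$, $\beta_i\in\mathbb{R}$; a posynomial is a finite sum of monomial functions. A geometric program is: minimize $p_0(z)$ subject to $p_i(z)\le 1$ ($1\le i\le m$) and $q_j(z)=1$ ($1\le j\le t$), where $p_0,\dots,p_m$ are posynomials and $q_1,\dots,q_t$ are monomial functions in $z\in\mathbb{R}^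N_{>0}$.
   Formalization: The equality is claimed only when the program has a real optimal value (R' nonempty); it fails for 1+x1^4+x2^4+x3^4-2x1^2x2^2-x3^2, where R' is empty but f_gp=3/4. Constraint (1) is read as void when f_{α(j)}=0. *)

theory Defs
  imports "HOL-Analysis.Analysis" "HOL-Library.Poly_Mapping"
begin

text \<open>
  An element of \<open>\<real>[x\<^sub>1, \<dots>, x\<^sub>n]\<close> with \<open>n = CARD('n)\<close> is an element of the monoid algebra
  \<open>(nat ^ 'n) \<Rightarrow>\<^sub>0 real\<close>, i.e. a finitely supported map from exponents to coefficients.
\<close>

type_synonym 'n mpoly = "(nat ^ 'n) \<Rightarrow>\<^sub>0 real"

definition rvec :: "nat ^ 'n \<Rightarrow> real ^ 'n" where
  "rvec \<beta> = (\<chi> i. real (\<beta> $ i))"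

definition even_exponent :: "nat ^ 'n \<Rightarrow> bool" where
  "even_exponent \<beta> \<longleftrightarrow> (\<forall>i. even (\<beta> $ i))"

text \<open>The zero polynomial gets degree 0.\<close>
definition total_degree :: "('n::finite) mpoly \<Rightarrow> nat" where
  "total_degree f = Max (insert 0 ((\<lambda>\<beta>. \<Sum>i\<in>UNIV. \<beta> $ i) ` Poly_Mapping.keys f))"

definition Delta :: "('n::finite) mpoly \<Rightarrow> (nat ^ 'n) set" where
  "Delta f = {\<beta>. Poly_Mapping.lookup f \<beta> < 0 \<or>
                  (\<not> even_exponent \<beta> \<and> Poly_Mapping.lookup f \<beta> > 0)}"

text \<open>
  Below, \<open>al j\<close> is the point \<open>\<alpha>(j)\<close>; only the indices \<open>j \<in> {0..CARD('n)}\<close> matter.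
  \<open>bary al \<beta> j\<close> is the coefficient \<open>\<lambda>\<^sub>j\<close> of \<open>\<beta>\<close>. It is meaningful when \<open>\<alpha>(0), \<dots>, \<alpha>(n)\<close> are
  affinely independent and \<open>\<beta>\<close> lies in their convex hull; extensionality outside \<open>{0..n}\<close>
  makes the coefficient function unique.
\<close>
definition is_bary :: "(nat \<Rightarrow> nat ^ 'n) \<Rightarrow> nat ^ ('n::finite) \<Rightarrow> (nat \<Rightarrow> real) \<Rightarrow> bool" where
  "is_bary al \<beta> c \<longleftrightarrow>
     c \<in> extensional {0..CARD('n)} \<and> (\<forall>j\<in>{0..CARD('n)}. c j \<ge> 0) \<and>
     (\<Sum>j=0..CARD('n). c j) = 1 \<and>
     rvec \<beta> = (\<Sum>j=0..CARD('n). c j *\<^sub>R rvec (al j))"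

definition bary :: "(nat \<Rightarrow> nat ^ 'n) \<Rightarrow> nat ^ ('n::finite) \<Rightarrow> nat \<Rightarrow> real" where
  "bary al \<beta> = (THE c. is_bary al \<beta> c)"

definition nz :: "(nat \<Rightarrow> nat ^ 'n) \<Rightarrow> nat ^ ('n::finite) \<Rightarrow> nat set" where
  "nz al \<beta> = {j \<in> {0..CARD('n)}. bary al \<beta> j \<noteq> 0}"

text \<open>
  The points \<open>al\<close> are part of the data: they are not determined by \<open>f\<close>, because the coefficient
  at \<open>\<alpha>(j)\<close> may vanish. The family \<open>\<alpha>(0) = 0, \<alpha>(1), \<dots>, \<alpha>(n)\<close> is required to be affinely
  independent including the point \<open>\<alpha>(0)\<close>, as needed for uniqueness of the \<open>\<lambda>\<^sub>j\<close>.
\<close>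
definition ST_standard_form :: "('n::finite) mpoly \<Rightarrow> (nat \<Rightarrow> nat ^ 'n) \<Rightarrow> bool" where
  "ST_standard_form f al \<longleftrightarrow>
     f = (\<Sum>j=0..CARD('n). Poly_Mapping.single (al j) (Poly_Mapping.lookup f (al j)))
       + (\<Sum>\<beta>\<in>Delta f. Poly_Mapping.single \<beta> (Poly_Mapping.lookup f \<beta>)) \<and>
     al 0 = 0 \<and>
     inj_on al {0..CARD('n)} \<and>
     \<not> affine_dependent (rvec ` al ` {0..CARD('n)}) \<and>
     (\<forall>j\<in>{0..CARD('n)}. even_exponent (al j)) \<and>
     rvec ` Delta f \<subseteq> convex hull (rvec ` al ` {0..CARD('n)}) \<and>
     (\<forall>j\<in>{0..CARD('n)}. Poly_Mapping.lookup f (al j) \<ge> 0 \<and>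
        (Poly_Mapping.lookup f (al j) = 0 \<longrightarrow> (\<forall>\<beta>\<in>Delta f. bary al \<beta> j = 0)))"

definition gp_cost :: "('n::finite) mpoly \<Rightarrow> (nat \<Rightarrow> nat ^ 'n) \<Rightarrow> ((nat ^ 'n) \<times> nat \<Rightarrow> real) \<Rightarrow> real" where
  "gp_cost f al a =
     (\<Sum>\<beta> | \<beta> \<in> Delta f \<and> 0 \<in> nz al \<beta>.
        bary al \<beta> 0 * \<bar>Poly_Mapping.lookup f \<beta>\<bar> powr (1 / bary al \<beta> 0) *
        (\<Prod>j | j \<in> nz al \<beta> \<and> j \<ge> 1. (bary al \<beta> j / a (\<beta>, j)) powr (bary al \<beta> j / bary al \<beta> 0)))"

definition gp_certificate ::
  "('n::finite) mpoly \<Rightarrow> (nat \<Rightarrow> nat ^ 'n) \<Rightarrow> real \<Rightarrow> ((nat ^ 'n) \<times> nat \<Rightarrow> real) \<Rightarrow> bool" where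
  "gp_certificate f al r a \<longleftrightarrow>
     (\<forall>\<beta>\<in>Delta f. \<forall>j\<in>{1..CARD('n)}. a (\<beta>, j) \<ge> 0) \<and>
     (\<forall>\<beta>\<in>Delta f. \<forall>j\<in>{1..CARD('n)}. bary al \<beta> j > 0 \<longrightarrow> a (\<beta>, j) > 0) \<and>
     (\<forall>\<beta>\<in>Delta f. bary al \<beta> 0 = 0 \<longrightarrow>
        \<bar>Poly_Mapping.lookup f \<beta>\<bar> \<le>
          (\<Prod>j | j \<in> nz al \<beta> \<and> j \<ge> 1. (a (\<beta>, j) / bary al \<beta> j) powr bary al \<beta> j)) \<and>
     (\<forall>j\<in>{1..CARD('n)}. Poly_Mapping.lookup f (al j) \<ge> (\<Sum>\<beta>\<in>Delta f. a (\<beta>, j))) \<and>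
     Poly_Mapping.lookup f (al 0) - r \<ge> gp_cost f al a"

text \<open>An extended real; it is \<open>- \<infinity>\<close> if no \<open>r\<close> is admissible.\<close>
definition f_gp :: "('n::finite) mpoly \<Rightarrow> (nat \<Rightarrow> nat ^ 'n) \<Rightarrow> ereal" where
  "f_gp f al = (SUP r \<in> {r. \<exists>a. gp_certificate f al r a}. ereal r)"

text \<open>The variables are indexed by a finite set \<open>I\<close>, so \<open>N = card I\<close>.\<close>

definition positive_orthant :: "'v set \<Rightarrow> ('v \<Rightarrow> real) set" where
  "positive_orthant I = (\<Pi>\<^sub>E i\<in>I. {0<..})"

definition monomial_fun :: "'v set \<Rightarrow> (('v \<Rightarrow> real) \<Rightarrow> real) \<Rightarrow> bool" where
  "monomial_fun I g \<longleftrightarrow>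
     (\<exists>c b. c > 0 \<and> (\<forall>z\<in>positive_orthant I. g z = c * (\<Prod>i\<in>I. z i powr b i)))"

text \<open>
  The empty sum is allowed: the cost below is the zero function when no \<open>\<beta>\<close> has \<open>\<lambda>\<^sub>0 \<noteq> 0\<close>.
\<close>
definition posynomial :: "'v set \<Rightarrow> (('v \<Rightarrow> real) \<Rightarrow> real) \<Rightarrow> bool" where
  "posynomial I g \<longleftrightarrow>
     (\<exists>(k::nat) m. (\<forall>i<k. monomial_fun I (m i)) \<and>
        (\<forall>z\<in>positive_orthant I. g z = (\<Sum>i<k. m i z)))"

text \<open>
  Minimize \<open>p0\<close> subject to \<open>p z \<le> 1\<close> for \<open>p \<in> P\<close> and \<open>q z = 1\<close> for \<open>q \<in> Q\<close>.
\<close>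
definition geometric_program ::
  "'v set \<Rightarrow> (('v \<Rightarrow> real) \<Rightarrow> real) \<Rightarrow> (('v \<Rightarrow> real) \<Rightarrow> real) set \<Rightarrow> (('v \<Rightarrow> real) \<Rightarrow> real) set \<Rightarrow> bool" where
  "geometric_program I p0 P Q \<longleftrightarrow>
     finite I \<and> finite P \<and> finite Q \<and>
     posynomial I p0 \<and> (\<forall>p\<in>P. posynomial I p) \<and> (\<forall>q\<in>Q. monomial_fun I q)"

definition gp_feasible ::
  "'v set \<Rightarrow> (('v \<Rightarrow> real) \<Rightarrow> real) set \<Rightarrow> (('v \<Rightarrow> real) \<Rightarrow> real) set \<Rightarrow> ('v \<Rightarrow> real) set" where
  "gp_feasible I P Q =
     {z \<in> positive_orthant I. (\<forall>p\<in>P. p z \<le> 1) \<and> (\<forall>q\<in>Q. q z = 1)}"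

text \<open>
  The optimal value is the greatest lower bound, in \<open>\<real>\<close>, of the objective on the feasible set;
  it need not be attained. An infeasible program has no optimal value in this sense, since then
  every real number is a lower bound. This matters for the comparison with \<open>f_gp\<close>: the variables
  \<open>a (\<beta>, j)\<close> with \<open>\<lambda>\<^sub>j = 0\<close> may be 0 in \<open>f_gp\<close> but are positive in the program, so the program can
  be infeasible although \<open>f_gp\<close> is finite. For
  \<open>x\<^sub>1^4 + x\<^sub>2^4 + x\<^sub>3^4 - 2 x\<^sub>1^2 x\<^sub>2^2 - x\<^sub>3^2\<close>, \<open>f_gp = -1/4\<close> and the feasible set is empty;
  with the convention \<open>Inf {} = \<infinity>\<close> the two values would not match.
\<close>
definition gp_optimal_value ::
  "'v set \<Rightarrow> (('v \<Rightarrow> real) \<Rightarrow> real) \<Rightarrow> (('v \<Rightarrow> real) \<Rightarrow> real) set \<Rightarrow> (('v \<Rightarrow> real) \<Rightarrow> real) set \<Rightarrow> real \<Rightarrow> bool" where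
  "gp_optimal_value I p0 P Q m \<longleftrightarrow>
     (\<forall>z\<in>gp_feasible I P Q. m \<le> p0 z) \<and>
     (\<forall>m'. (\<forall>z\<in>gp_feasible I P Q. m' \<le> p0 z) \<longrightarrow> m' \<le> m)"

text \<open>\<open>R\<close> is \<open>positive_orthant (gp_index f)\<close>.\<close>
definition gp_index :: "('n::finite) mpoly \<Rightarrow> ((nat ^ 'n) \<times> nat) set" where
  "gp_index f = Delta f \<times> {1..CARD('n)}"

text \<open>
  If the coefficient at \<open>\<alpha>(j)\<close> vanishes, the left-hand side is 0 by \<open>x / 0 = 0\<close>, so that the
  constraint is void. (Then \<open>\<lambda>\<^sub>j = 0\<close> for all \<open>\<beta>\<close>, so the \<open>a (\<beta>, j)\<close> occur nowhere else.)
\<close>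
definition vertex_constraint ::
  "('n::finite) mpoly \<Rightarrow> (nat \<Rightarrow> nat ^ 'n) \<Rightarrow> nat \<Rightarrow> ((nat ^ 'n) \<times> nat \<Rightarrow> real) \<Rightarrow> real" where
  "vertex_constraint f al j a = (\<Sum>\<beta>\<in>Delta f. a (\<beta>, j) / Poly_Mapping.lookup f (al j))"

definition face_constraint ::
  "('n::finite) mpoly \<Rightarrow> (nat \<Rightarrow> nat ^ 'n) \<Rightarrow> nat ^ 'n \<Rightarrow> ((nat ^ 'n) \<times> nat \<Rightarrow> real) \<Rightarrow> real" where
  "face_constraint f al \<beta> a =
     \<bar>Poly_Mapping.lookup f \<beta>\<bar> *
     (\<Prod>j | j \<in> nz al \<beta> \<and> j \<ge> 1. (bary al \<beta> j / a (\<beta>, j)) powr bary al \<beta> j)"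

definition gp_constraints ::
  "('n::finite) mpoly \<Rightarrow> (nat \<Rightarrow> nat ^ 'n) \<Rightarrow> (((nat ^ 'n) \<times> nat \<Rightarrow> real) \<Rightarrow> real) set" where
  "gp_constraints f al =
     vertex_constraint f al ` {1..CARD('n)} \<union>
     face_constraint f al ` {\<beta> \<in> Delta f. bary al \<beta> 0 = 0}"

end

theory Submission
  imports Defs
begin

text \<open>
  Dividing the conditions of a certificate by the coefficients turns them into the constraints of
  the program. What remains is a difference of domains: a certificate may use \<open>a (\<beta>, j) = 0\<close>
  where \<open>\<lambda>\<^sub>j = 0\<close>, and has to if the coefficient at \<open>\<alpha>(j)\<close> vanishes, while the variables of the
  program are positive. Both inequalities are therefore a matter of passing between the two domains.

  From a feasible point one gets a certificate with the same cost by setting \<open>a (\<beta>, j) = 0\<close>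
  whenever the coefficient at \<open>\<alpha>(j)\<close> vanishes: by the last condition in the definition of an
  ST-polynomial this changes no coordinate that enters the cost or a face condition
  (\<open>certificate_of_feasible\<close>). Conversely, a certificate \<open>a\<close> is a limit of feasible points, as
  soon as there is one feasible point \<open>z\<close>: the points \<open>(1 - t) a + t z\<close> with \<open>0 < t \<le> 1\<close> are
  positive, the vertex constraints are linear, and the face constraints describe superlevel sets of
  the log-concave function \<open>\<Prod>\<^sub>j (a\<^sub>j / \<lambda>\<^sub>j) powr \<lambda>\<^sub>j\<close> (\<open>feasible_segment\<close>). The cost is
  continuous along this segment down to \<open>t = 0\<close>, because it involves only coordinates in which
  \<open>a\<close> is positive (\<open>certificate_bound\<close>). A feasible point exists whenever the program has an optimal
  value, because the empty set has no greatest lower bound in \<open>\<real>\<close>.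
\<close>

section \<open>Monomials and posynomials\<close>

lemma monomial_fun_quotient:
  assumes "finite I" "i \<in> I" "c > 0"
  shows "monomial_fun I (\<lambda>z. z i / c)"
proof -
  have "z i / c = 1 / c * (\<Prod>k\<in>I. z k powr (if k = i then 1 else 0))"
    if z: "z \<in> positive_orthant I" for z
  proof -
    have pos: "z k > 0" "z k \<noteq> 0" if "k \<in> I" for k
      using z that by (force simp: positive_orthant_def)+
    have "(\<Prod>k\<in>I. z k powr (if k = i then 1 else 0)) = (\<Prod>k\<in>I. if k = i then z k else 1)"
      using pos by (intro prod.cong) (auto simp: less_imp_le)
    then show ?thesis
      using assms by simp
  qed
  then show ?thesis
    unfolding monomial_fun_def using assms(3)
    by (intro exI[of _ "1 / c"] exI[of _ "\<lambda>k. if k = i then 1 else 0"]) simp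
qed

lemma monomial_fun_prod_powr:
  assumes I: "finite I" and h: "inj_on h J" "h ` J \<subseteq> I"
    and c: "c > 0" and w: "\<And>j. j \<in> J \<Longrightarrow> w j > 0"
  shows "monomial_fun I (\<lambda>z. c * (\<Prod>j\<in>J. (w j / z (h j)) powr p j))"
proof -
  define b where "b i = (if i \<in> h ` J then - p (the_inv_into J h i) else 0)" for i
  let ?C = "c * (\<Prod>j\<in>J. w j powr p j)"
  have "c * (\<Prod>j\<in>J. (w j / z (h j)) powr p j) = ?C * (\<Prod>i\<in>I. z i powr b i)"
    if z: "z \<in> positive_orthant I" for z
  proof -
    have pos: "z k > 0" "z k \<noteq> 0" if "k \<in> I" for k
      using z that by (force simp: positive_orthant_def)+
    have "(\<Prod>i\<in>I. z i powr b i) = (\<Prod>i\<in>h ` J. z i powr b i)"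
      using I h(2) pos by (intro prod.mono_neutral_right) (auto simp: b_def)
    also have "\<dots> = (\<Prod>j\<in>J. z (h j) powr - p j)"
      using h(1) by (simp add: prod.reindex b_def the_inv_into_f_f)
    finally have "(\<Prod>i\<in>I. z i powr b i) = (\<Prod>j\<in>J. z (h j) powr - p j)" .
    then show ?thesis
      by (simp add: powr_divide powr_minus_divide prod_dividef)
  qed
  moreover have "?C > 0"
    using c w by (intro mult_pos_pos prod_pos) (simp_all add: less_imp_neq[symmetric])
  ultimately show ?thesis
    unfolding monomial_fun_def by (intro exI[of _ ?C] exI[of _ b]) simp
qed

lemma posynomial_sum:
  assumes "finite S" "\<And>s. s \<in> S \<Longrightarrow> monomial_fun I (g s)"
  shows "posynomial I (\<lambda>z. \<Sum>s\<in>S. g s z)"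
proof -
  obtain h where h: "bij_betw h {0..<card S} S"
    using ex_bij_betw_nat_finite[OF assms(1)] by blast
  have "(\<Sum>s\<in>S. g s z) = (\<Sum>i<card S. g (h i) z)" for z
    using sum.reindex_bij_betw[OF h, of "\<lambda>s. g s z"] by (simp add: lessThan_atLeast0)
  moreover have "\<forall>i<card S. monomial_fun I (g (h i))"
    using bij_betwE[OF h] assms(2) by simp
  ultimately show ?thesis
    unfolding posynomial_def by (intro exI[of _ "card S"] exI[of _ "\<lambda>i. g (h i)"]) simp
qed

section \<open>Barycentric coordinates\<close>

lemma inj_rvec: "inj rvec"
  by (auto simp: inj_def rvec_def vec_eq_iff)

lemma is_bary_unique:
  fixes al :: "nat \<Rightarrow> nat ^ ('n::finite)"
  assumes inj: "inj_on al {0..CARD('n)}"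
    and indep: "\<not> affine_dependent (rvec ` al ` {0..CARD('n)})"
    and c: "is_bary al \<beta> c" and c': "is_bary al \<beta> c'"
  shows "c = c'"
proof -
  let ?N = "{0..CARD('n)}"
  let ?v = "\<lambda>j. rvec (al j)"
  have injv: "inj_on ?v ?N"
    using inj inj_rvec by (auto simp: inj_on_def)
  have image: "rvec ` al ` ?N = ?v ` ?N"
    by auto
  define U where "U = (\<lambda>j. c j - c' j) \<circ> the_inv_into ?N ?v"
  have U: "U (?v j) = c j - c' j" if "j \<in> ?N" for j
    using the_inv_into_f_f[OF injv that] by (simp add: U_def)
  have "sum U (?v ` ?N) = (\<Sum>j\<in>?N. c j - c' j)"
    using injv U by (simp add: sum.reindex)
  also have "\<dots> = 0"
    using c c' by (simp add: is_bary_def sum_subtractf)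
  finally have 1: "sum U (?v ` ?N) = 0" .
  have "(\<Sum>v\<in>?v ` ?N. U v *\<^sub>R v) = (\<Sum>j\<in>?N. (c j - c' j) *\<^sub>R ?v j)"
    using injv U by (simp add: sum.reindex)
  also have "\<dots> = 0"
    using c c' by (simp add: is_bary_def scaleR_diff_left sum_subtractf)
  finally have 2: "(\<Sum>v\<in>?v ` ?N. U v *\<^sub>R v) = 0" .
  have "\<forall>v\<in>?v ` ?N. U v = 0"
    using indep 1 2 unfolding image by (subst (asm) affine_dependent_explicit_finite) auto
  then have eq: "c j = c' j" if "j \<in> ?N" for j
    using that U by fastforce
  show ?thesis
  proof (rule extensionalityI[of _ ?N])
    show "c \<in> extensional ?N" "c' \<in> extensional ?N"
      using c c' by (auto simp: is_bary_def)
  qed (use eq in auto)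
qed

lemma is_bary_exists:
  fixes al :: "nat \<Rightarrow> nat ^ ('n::finite)"
  assumes inj: "inj_on al {0..CARD('n)}"
    and hull: "rvec \<beta> \<in> convex hull (rvec ` al ` {0..CARD('n)})"
  shows "\<exists>c. is_bary al \<beta> c"
proof -
  let ?N = "{0..CARD('n)}"
  let ?v = "\<lambda>j. rvec (al j)"
  have injv: "inj_on ?v ?N"
    using inj inj_rvec by (auto simp: inj_on_def)
  have image: "rvec ` al ` ?N = ?v ` ?N"
    by auto
  obtain u where u: "\<forall>x\<in>?v ` ?N. 0 \<le> u x" "sum u (?v ` ?N) = 1"
      "(\<Sum>x\<in>?v ` ?N. u x *\<^sub>R x) = rvec \<beta>"
    using hull unfolding image by (subst (asm) convex_hull_finite) auto
  have "is_bary al \<beta> (restrict (u \<circ> ?v) ?N)"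
    unfolding is_bary_def using u injv by (simp add: sum.reindex)
  then show ?thesis
    by blast
qed

text \<open>
  Affine independence and containment in the convex hull make the description in \<open>bary\<close> a proper
  one, so that \<open>bary\<close> inherits the properties required by \<open>is_bary\<close>.
\<close>
lemma bary_nonneg:
  fixes f :: "('n::finite) mpoly"
  assumes ST: "ST_standard_form f al" and "\<beta> \<in> Delta f" "j \<in> {0..CARD('n)}"
  shows "0 \<le> bary al \<beta> j"
proof -
  have "\<exists>!c. is_bary al \<beta> c"
    using ST \<open>\<beta> \<in> Delta f\<close> is_bary_exists is_bary_unique
    unfolding ST_standard_form_def by (metis image_subset_iff)
  then have "is_bary al \<beta> (bary al \<beta>)"
    unfolding bary_def by (rule theI')
  then show ?thesis
    using assms(3) by (auto simp: is_bary_def)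
qed

lemma bary_pos_of_nz:
  fixes f :: "('n::finite) mpoly"
  assumes "ST_standard_form f al" "\<beta> \<in> Delta f" "j \<in> nz al \<beta>"
  shows "0 < bary al \<beta> j"
  using bary_nonneg[OF assms(1,2), of j] assms(3) by (auto simp: nz_def)

lemma finite_nz [simp]: "finite (nz al \<beta>)"
  by (simp add: nz_def)

lemma lookup_Delta_nonzero: "\<beta> \<in> Delta f \<Longrightarrow> Poly_Mapping.lookup f \<beta> \<noteq> 0"
  by (auto simp: Delta_def)

lemma finite_Delta [simp]: "finite (Delta f)"
  by (rule finite_subset[OF _ finite_keys[of f]]) (auto simp: Delta_def in_keys_iff)

section \<open>The program is a geometric program\<close>

lemma posynomial_gp_cost:
  fixes f :: "('n::finite) mpoly"
  assumes ST: "ST_standard_form f al"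
  shows "posynomial (gp_index f) (gp_cost f al)"
proof -
  have coeff: "bary al \<beta> 0 * \<bar>Poly_Mapping.lookup f \<beta>\<bar> powr (1 / bary al \<beta> 0) > 0"
    if "\<beta> \<in> Delta f" "0 \<in> nz al \<beta>" for \<beta>
    using bary_pos_of_nz[OF ST that] lookup_Delta_nonzero[OF that(1)] by simp
  have "posynomial (gp_index f) (\<lambda>a. \<Sum>\<beta> | \<beta> \<in> Delta f \<and> 0 \<in> nz al \<beta>.
        bary al \<beta> 0 * \<bar>Poly_Mapping.lookup f \<beta>\<bar> powr (1 / bary al \<beta> 0) *
        (\<Prod>j | j \<in> nz al \<beta> \<and> j \<ge> 1. (bary al \<beta> j / a (\<beta>, j)) powr (bary al \<beta> j / bary al \<beta> 0)))"
    using bary_pos_of_nz[OF ST] coeff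
    by (intro posynomial_sum monomial_fun_prod_powr)
      (auto simp: gp_index_def nz_def inj_on_def)
  then show ?thesis
    by (simp add: gp_cost_def[abs_def])
qed

lemma posynomial_vertex_constraint:
  fixes f :: "('n::finite) mpoly"
  assumes ST: "ST_standard_form f al" and j: "j \<in> {1..CARD('n)}"
  shows "posynomial (gp_index f) (vertex_constraint f al j)"
proof (cases "Poly_Mapping.lookup f (al j) = 0")
  case True
  then show ?thesis
    unfolding posynomial_def vertex_constraint_def by (intro exI[of _ 0]) simp
next
  case False
  have "Poly_Mapping.lookup f (al j) \<ge> 0"
    using ST j by (auto simp: ST_standard_form_def)
  with False j show ?thesis
    unfolding vertex_constraint_def
    by (intro posynomial_sum monomial_fun_quotient) (auto simp: gp_index_def)
qed

lemma posynomial_face_constraint: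
  fixes f :: "('n::finite) mpoly"
  assumes ST: "ST_standard_form f al" and \<beta>: "\<beta> \<in> Delta f"
  shows "posynomial (gp_index f) (face_constraint f al \<beta>)"
proof -
  have "monomial_fun (gp_index f) (face_constraint f al \<beta>)"
    unfolding face_constraint_def
    using bary_pos_of_nz[OF ST \<beta>] lookup_Delta_nonzero[OF \<beta>] \<beta>
    by (intro monomial_fun_prod_powr) (auto simp: gp_index_def nz_def inj_on_def)
  from posynomial_sum[of "{()}" _ "\<lambda>_. face_constraint f al \<beta>", OF _ this] show ?thesis
    by simp
qed

lemma geometric_program_ST:
  assumes "ST_standard_form f al"
  shows "geometric_program (gp_index f) (gp_cost f al) (gp_constraints f al) {}"
  using posynomial_gp_cost[OF assms] posynomial_vertex_constraint[OF assms]
    posynomial_face_constraint[OF assms]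
  by (auto simp: geometric_program_def gp_constraints_def gp_index_def)

section \<open>Feasible points and certificates\<close>

lemma face_constraint_le_1_iff:
  fixes f :: "('n::finite) mpoly"
  assumes ST: "ST_standard_form f al" and \<beta>: "\<beta> \<in> Delta f"
    and a: "\<And>j. j \<in> nz al \<beta> \<Longrightarrow> j \<ge> 1 \<Longrightarrow> a (\<beta>, j) > 0"
  shows "face_constraint f al \<beta> a \<le> 1 \<longleftrightarrow> \<bar>Poly_Mapping.lookup f \<beta>\<bar> \<le>
    (\<Prod>j | j \<in> nz al \<beta> \<and> j \<ge> 1. (a (\<beta>, j) / bary al \<beta> j) powr bary al \<beta> j)"
    (is "_ \<longleftrightarrow> _ \<le> ?P")
proof -
  have "?P > 0"
    using a bary_pos_of_nz[OF ST \<beta>] by (intro prod_pos) force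
  moreover have "face_constraint f al \<beta> a = \<bar>Poly_Mapping.lookup f \<beta>\<bar> / ?P"
    by (simp add: face_constraint_def powr_divide prod_dividef)
  ultimately show ?thesis
    by (simp add: divide_le_eq)
qed

text \<open>
  The constraints in the form that certificates use, with the denominators cleared. In this form
  they are visibly convex: the vertex constraints are linear, and the product in the face
  constraints is log-concave. Where a coefficient vanishes, there is no denominator to clear and
  the vertex constraint is void.
\<close>
lemma gp_feasible_iff:
  fixes f :: "('n::finite) mpoly"
  assumes ST: "ST_standard_form f al"
  shows "z \<in> gp_feasible (gp_index f) (gp_constraints f al) {} \<longleftrightarrow>
    z \<in> positive_orthant (gp_index f) \<and>
    (\<forall>j\<in>{1..CARD('n)}. Poly_Mapping.lookup f (al j) \<noteq> 0 \<longrightarrow>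
      (\<Sum>\<beta>\<in>Delta f. z (\<beta>, j)) \<le> Poly_Mapping.lookup f (al j)) \<and>
    (\<forall>\<beta>\<in>Delta f. bary al \<beta> 0 = 0 \<longrightarrow> \<bar>Poly_Mapping.lookup f \<beta>\<bar> \<le>
      (\<Prod>j | j \<in> nz al \<beta> \<and> j \<ge> 1. (z (\<beta>, j) / bary al \<beta> j) powr bary al \<beta> j))"
proof -
  have "vertex_constraint f al j z \<le> 1 \<longleftrightarrow> (Poly_Mapping.lookup f (al j) \<noteq> 0 \<longrightarrow>
      (\<Sum>\<beta>\<in>Delta f. z (\<beta>, j)) \<le> Poly_Mapping.lookup f (al j))" if "j \<in> {1..CARD('n)}" for j
  proof -
    have "Poly_Mapping.lookup f (al j) \<ge> 0"
      using ST that by (auto simp: ST_standard_form_def)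
    then show ?thesis
      by (auto simp: vertex_constraint_def sum_divide_distrib[symmetric] divide_le_eq)
  qed
  moreover have "face_constraint f al \<beta> z \<le> 1 \<longleftrightarrow> \<bar>Poly_Mapping.lookup f \<beta>\<bar> \<le>
      (\<Prod>j | j \<in> nz al \<beta> \<and> j \<ge> 1. (z (\<beta>, j) / bary al \<beta> j) powr bary al \<beta> j)"
    if "z \<in> positive_orthant (gp_index f)" "\<beta> \<in> Delta f" for \<beta>
    using that by (intro face_constraint_le_1_iff[OF ST])
      (auto simp: positive_orthant_def gp_index_def nz_def)
  ultimately show ?thesis
    by (auto simp: gp_feasible_def gp_constraints_def ball_Un)
qed

lemma gp_cost_cong:
  assumes "\<And>\<beta> j. \<beta> \<in> Delta f \<Longrightarrow> j \<in> nz al \<beta> \<Longrightarrow> j \<ge> 1 \<Longrightarrow> a (\<beta>, j) = b (\<beta>, j)"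
  shows "gp_cost f al a = gp_cost f al b"
  unfolding gp_cost_def using assms by (auto intro!: sum.cong prod.cong)

text \<open>
  Where the coefficient at \<open>\<alpha>(j)\<close> is zero, the program does not bound \<open>z (\<beta>, j)\<close> but a certificate
  forces it to be \<open>0\<close>; resetting it is harmless because then \<open>j \<notin> nz al \<beta>\<close>.
\<close>
lemma certificate_of_feasible:
  fixes f :: "('n::finite) mpoly"
  assumes ST: "ST_standard_form f al"
    and z: "z \<in> gp_feasible (gp_index f) (gp_constraints f al) {}"
  shows "\<exists>a. gp_certificate f al (Poly_Mapping.lookup f (al 0) - gp_cost f al z) a"
proof -
  define a where "a = (\<lambda>(\<beta>, j). if Poly_Mapping.lookup f (al j) = 0 then 0 else z (\<beta>, j))"
  note feas = z[unfolded gp_feasible_iff[OF ST]]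
  have pos: "z (\<beta>, j) > 0" if "\<beta> \<in> Delta f" "j \<in> {1..CARD('n)}" for \<beta> j
    using feas that by (auto simp: positive_orthant_def gp_index_def)
  have nonzero: "Poly_Mapping.lookup f (al j) \<noteq> 0"
    if "\<beta> \<in> Delta f" "j \<in> {0..CARD('n)}" "bary al \<beta> j \<noteq> 0" for \<beta> j
    using ST that unfolding ST_standard_form_def by blast
  have eq: "a (\<beta>, j) = z (\<beta>, j)" if "\<beta> \<in> Delta f" "j \<in> nz al \<beta>" for \<beta> j
    using nonzero[of \<beta> j] that by (auto simp: a_def nz_def)
  have "gp_certificate f al (Poly_Mapping.lookup f (al 0) - gp_cost f al z) a"
    unfolding gp_certificate_def
  proof (intro conjI ballI impI)
    fix \<beta> j assume *: "\<beta> \<in> Delta f" "j \<in> {1..CARD('n)}"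
    then show "a (\<beta>, j) \<ge> 0"
      using pos[OF *] by (auto simp: a_def)
    assume "bary al \<beta> j > 0"
    with * show "a (\<beta>, j) > 0"
      using pos[OF *] nonzero[of \<beta> j] by (auto simp: a_def)
  next
    fix \<beta> assume *: "\<beta> \<in> Delta f" "bary al \<beta> 0 = 0"
    have "(\<Prod>j | j \<in> nz al \<beta> \<and> j \<ge> 1. (a (\<beta>, j) / bary al \<beta> j) powr bary al \<beta> j) =
        (\<Prod>j | j \<in> nz al \<beta> \<and> j \<ge> 1. (z (\<beta>, j) / bary al \<beta> j) powr bary al \<beta> j)"
      using eq[OF *(1)] by (intro prod.cong) auto
    then show "\<bar>Poly_Mapping.lookup f \<beta>\<bar> \<le>
        (\<Prod>j | j \<in> nz al \<beta> \<and> j \<ge> 1. (a (\<beta>, j) / bary al \<beta> j) powr bary al \<beta> j)"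
      using feas * by auto
  next
    fix j assume "j \<in> {1..CARD('n)}"
    then show "(\<Sum>\<beta>\<in>Delta f. a (\<beta>, j)) \<le> Poly_Mapping.lookup f (al j)"
      using feas by (cases "Poly_Mapping.lookup f (al j) = 0") (simp_all add: a_def)
  next
    have "gp_cost f al a = gp_cost f al z"
      using eq by (intro gp_cost_cong)
    then show "gp_cost f al a \<le>
        Poly_Mapping.lookup f (al 0) - (Poly_Mapping.lookup f (al 0) - gp_cost f al z)"
      by simp
  qed
  then show ?thesis
    by blast
qed

text \<open>
  Log-concavity of \<open>x \<mapsto> \<Prod>\<^sub>j x\<^sub>j powr p\<^sub>j\<close> on the positive orthant: apply the weighted
  inequality of arithmetic and geometric means in each factor.
\<close>
lemma prod_powr_log_concave:
  fixes x y p :: "'a \<Rightarrow> real"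
  assumes t: "0 \<le> t" "t \<le> 1"
    and xy: "\<And>j. j \<in> J \<Longrightarrow> x j > 0" "\<And>j. j \<in> J \<Longrightarrow> y j > 0" "\<And>j. j \<in> J \<Longrightarrow> p j \<ge> 0"
  shows "(\<Prod>j\<in>J. x j powr p j) powr (1 - t) * (\<Prod>j\<in>J. y j powr p j) powr t
    \<le> (\<Prod>j\<in>J. ((1 - t) * x j + t * y j) powr p j)"
proof -
  have "(\<Prod>j\<in>J. x j powr p j) powr (1 - t) * (\<Prod>j\<in>J. y j powr p j) powr t
      = (\<Prod>j\<in>J. (x j powr (1 - t) * y j powr t) powr p j)"
    by (simp add: prod_powr_distrib prod.distrib powr_mult powr_powr mult.commute)
  also have "\<dots> \<le> (\<Prod>j\<in>J. ((1 - t) * x j + t * y j) powr p j)"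
    using t xy by (intro prod_mono conjI powr_mono2 Youngs_inequality_0) auto
  finally show ?thesis .
qed

lemma feasible_segment:
  fixes f :: "('n::finite) mpoly"
  assumes ST: "ST_standard_form f al"
    and z: "z \<in> gp_feasible (gp_index f) (gp_constraints f al) {}"
    and a: "gp_certificate f al r a" and t: "0 < t" "t \<le> 1"
  shows "restrict (\<lambda>i. (1 - t) * a i + t * z i) (gp_index f)
    \<in> gp_feasible (gp_index f) (gp_constraints f al) {}"
  unfolding gp_feasible_iff[OF ST]
proof (intro conjI ballI impI)
  note feas = z[unfolded gp_feasible_iff[OF ST]]
  note cert = a[unfolded gp_certificate_def]
  let ?b = "restrict (\<lambda>i. (1 - t) * a i + t * z i) (gp_index f)"
  have b: "?b (\<beta>, j) = (1 - t) * a (\<beta>, j) + t * z (\<beta>, j)"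
    if "\<beta> \<in> Delta f" "j \<in> {1..CARD('n)}" for \<beta> j
    using that by (simp add: gp_index_def)
  have zpos: "z (\<beta>, j) > 0" if "\<beta> \<in> Delta f" "j \<in> {1..CARD('n)}" for \<beta> j
    using feas that by (auto simp: positive_orthant_def gp_index_def)
  show "?b \<in> positive_orthant (gp_index f)"
    unfolding positive_orthant_def using zpos cert t
    by (auto simp: gp_index_def intro!: add_nonneg_pos)
  show "(\<Sum>\<beta>\<in>Delta f. ?b (\<beta>, j)) \<le> Poly_Mapping.lookup f (al j)"
    if j: "j \<in> {1..CARD('n)}" and "Poly_Mapping.lookup f (al j) \<noteq> 0" for j
  proof -
    have "(\<Sum>\<beta>\<in>Delta f. ?b (\<beta>, j)) =
        (1 - t) * (\<Sum>\<beta>\<in>Delta f. a (\<beta>, j)) + t * (\<Sum>\<beta>\<in>Delta f. z (\<beta>, j))"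
      using j b by (simp add: sum.distrib sum_distrib_left)
    also have "\<dots> \<le> Poly_Mapping.lookup f (al j)"
      using cert feas that t by (intro convex_bound_le) auto
    finally show ?thesis .
  qed
  show "\<bar>Poly_Mapping.lookup f \<beta>\<bar> \<le>
      (\<Prod>j | j \<in> nz al \<beta> \<and> j \<ge> 1. (?b (\<beta>, j) / bary al \<beta> j) powr bary al \<beta> j)"
    if \<beta>: "\<beta> \<in> Delta f" and 0: "bary al \<beta> 0 = 0" for \<beta>
  proof -
    let ?J = "{j. j \<in> nz al \<beta> \<and> j \<ge> 1}"
    let ?P = "\<lambda>a. \<Prod>j\<in>?J. (a (\<beta>, j) / bary al \<beta> j) powr bary al \<beta> j"
    have \<lambda>: "bary al \<beta> j > 0" if "j \<in> ?J" for j
      using bary_pos_of_nz[OF ST \<beta>] that by auto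
    have J: "j \<in> {1..CARD('n)}" if "j \<in> ?J" for j
      using that by (auto simp: nz_def)
    have apos: "a (\<beta>, j) > 0" if "j \<in> ?J" for j
      using cert \<beta> J[OF that] \<lambda>[OF that] by blast
    have "\<bar>Poly_Mapping.lookup f \<beta>\<bar>
        = \<bar>Poly_Mapping.lookup f \<beta>\<bar> powr (1 - t) * \<bar>Poly_Mapping.lookup f \<beta>\<bar> powr t"
      using lookup_Delta_nonzero[OF \<beta>] by (simp flip: powr_add)
    also have "\<dots> \<le> ?P a powr (1 - t) * ?P z powr t"
      using cert feas \<beta> 0 t by (intro mult_mono powr_mono2) auto
    also have "\<dots> \<le> (\<Prod>j\<in>?J.
        ((1 - t) * (a (\<beta>, j) / bary al \<beta> j) + t * (z (\<beta>, j) / bary al \<beta> j)) powr bary al \<beta> j)"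
      using t \<lambda> apos zpos[OF \<beta> J]
      by (intro prod_powr_log_concave) (auto intro!: divide_pos_pos less_imp_le)
    also have "\<dots> = ?P ?b"
      using b[OF \<beta> J] by (intro prod.cong) (auto simp: add_divide_distrib)
    finally show ?thesis .
  qed
qed

text \<open>
  Let \<open>t\<close> tend to \<open>0\<close> from the right in \<open>feasible_segment\<close>. Only coordinates with \<open>\<lambda>\<^sub>j > 0\<close> enter
  the cost; there \<open>a\<close> is positive, so no denominator tends to \<open>0\<close>.
\<close>
lemma certificate_bound:
  fixes f :: "('n::finite) mpoly"
  assumes ST: "ST_standard_form f al"
    and z: "z \<in> gp_feasible (gp_index f) (gp_constraints f al) {}"
    and lower: "\<And>z. z \<in> gp_feasible (gp_index f) (gp_constraints f al) {} \<Longrightarrow> m \<le> gp_cost f al z"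
    and a: "gp_certificate f al r a"
  shows "r \<le> Poly_Mapping.lookup f (al 0) - m"
proof -
  define b where "b t i = (1 - t) * a i + t * z i" for t i
  note cert = a[unfolded gp_certificate_def]
  have "m \<le> gp_cost f al (b t)" if "0 < t" "t \<le> 1" for t
  proof -
    have "gp_cost f al (restrict (b t) (gp_index f)) = gp_cost f al (b t)"
      by (intro gp_cost_cong) (auto simp: gp_index_def nz_def)
    then show ?thesis
      using lower[OF feasible_segment[OF ST z a that]] by (simp add: b_def[abs_def])
  qed
  then have ev: "\<forall>\<^sub>F t in at_right 0. m \<le> gp_cost f al (b t)"
    by (intro eventually_at_rightI[of 0 1]) auto
  have lim: "((\<lambda>t. b t i) \<longlongrightarrow> a i) (at_right 0)" for i
    unfolding b_def by (auto intro!: tendsto_eq_intros)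
  have "((\<lambda>t. gp_cost f al (b t)) \<longlongrightarrow> gp_cost f al a) (at_right 0)"
    unfolding gp_cost_def
  proof (intro tendsto_sum tendsto_mult tendsto_const tendsto_prod tendsto_powr tendsto_divide lim)
    fix \<beta> j
    assume "\<beta> \<in> {\<beta>. \<beta> \<in> Delta f \<and> 0 \<in> nz al \<beta>}" and "j \<in> {j. j \<in> nz al \<beta> \<and> j \<ge> 1}"
    then have *: "\<beta> \<in> Delta f" "j \<in> {1..CARD('n)}" "bary al \<beta> j > 0"
      using bary_pos_of_nz[OF ST] by (auto simp: nz_def)
    then have "a (\<beta>, j) > 0"
      using cert by blast
    then show "a (\<beta>, j) \<noteq> 0" "bary al \<beta> j / a (\<beta>, j) \<noteq> 0"
      using * by auto
  qed
  then have "m \<le> gp_cost f al a"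
    using ev by (rule tendsto_lowerbound) simp
  then show ?thesis
    using cert by linarith
qed

section \<open>The optimal value\<close>

lemma f_gp_eq:
  fixes f :: "('n::finite) mpoly"
  assumes ST: "ST_standard_form f al"
    and opt: "gp_optimal_value (gp_index f) (gp_cost f al) (gp_constraints f al) {} m"
  shows "f_gp f al = ereal (Poly_Mapping.lookup f (al 0) - m)"
proof (rule antisym)
  let ?F = "gp_feasible (gp_index f) (gp_constraints f al) {}"
  let ?f0 = "Poly_Mapping.lookup f (al 0)"
  have lower: "m \<le> gp_cost f al z" if "z \<in> ?F" for z
    using opt that by (simp add: gp_optimal_value_def)
  have greatest: "m' \<le> m" if "\<And>z. z \<in> ?F \<Longrightarrow> m' \<le> gp_cost f al z" for m'
    using opt that by (simp add: gp_optimal_value_def)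
  \<comment> \<open>If there were no feasible point, then \<open>m + 1\<close> would also be a lower bound.\<close>
  obtain z where z: "z \<in> ?F"
    using greatest[of "m + 1"] by fastforce
  show upper: "f_gp f al \<le> ereal (?f0 - m)"
    unfolding f_gp_def using certificate_bound[OF ST z lower] by (auto intro!: SUP_least)
  have cost: "ereal (?f0 - gp_cost f al y) \<le> f_gp f al" if "y \<in> ?F" for y
    unfolding f_gp_def using certificate_of_feasible[OF ST that] by (intro SUP_upper) simp
  obtain s where s: "f_gp f al = ereal s"
    using upper cost[OF z] by (cases "f_gp f al") auto
  have "?f0 - s \<le> m"
    using cost s by (intro greatest) (force simp: algebra_simps)
  then show "ereal (?f0 - m) \<le> f_gp f al"
    using s by simp
qed

theorem corollary4p2:
  fixes f :: "('n::finite) mpoly" and al :: "nat \<Rightarrow> nat ^ 'n" and d :: nat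
  assumes "ST_standard_form f al"
    and "total_degree f = 2 * d"
  shows "geometric_program (gp_index f) (gp_cost f al) (gp_constraints f al) {} \<and>
    (\<forall>m :: real. gp_optimal_value (gp_index f) (gp_cost f al) (gp_constraints f al) {} m \<longrightarrow>
       f_gp f al = ereal (Poly_Mapping.lookup f 0 - m))"
proof -
  have "al 0 = 0"
    using assms(1) by (simp add: ST_standard_form_def)
  then show ?thesis
    using geometric_program_ST[OF assms(1)] f_gp_eq[OF assms(1)] by simp
qed

end
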